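(* Let $n\ge 2$, let $I_n$ be the identity matrix of order $n$, let $\mathcal{E}_n=\mathcal{E}_n(0)$ be the $n\times n$ matrix whose $(i,j)$ entry ($1\le i,j\le n$) is $\binom{i-1}{j-1}_M E_{i-j,M}$ if $i\ge j$ and $0$ otherwise, and let $\mathcal{M}_n=\mathcal{M}_n(1)$ be the $n\times n$ matrix whose $(i,j)$ entry is $\binom{i-1}{j-1}_M$ if $i\ge j$ and $0$ otherwise. Then $\mathcal{E}_n$ is invertible and \[\mathcal{E}_n^{-1}=\tfrac12(\mathcal{M}_n+I_n).\]
   Context: The Mersenne numbers are $M_n=2^n-1$ ($n\ge 0$). The $M$-factorial is $M_0!=1$, $M_n!=M_nM_{n-1}!$ for $n\ge1$. The $M$-binomial coefficients are $\binom{n}{k}_M=\frac{M_n!}{M_k!M_{n-k}!}$ for $n\ge k\ge 0$ and $\binom nk_M=0$ for $k>n$. The $M$-exponential is $e_M^{xt}=\sum_{n\ge0}x^n\frac{t^n}{M_n!}$. The Mersenne-Euler polynomials $E_{n,M}(x)$ are defined by $\frac{2 e_M^{xt}}{e_M^t+1}=\sum_{n\ge0}E_{n,M}(x)\frac{t^n}{M_n!}$ (as power series in $t$), and $E_{n,M}=E_{n,M}(0)$. *)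

theory Defs
  imports
    "Jordan_Normal_Form.Matrix"
    "HOL-Computational_Algebra.Polynomial"
    "HOL-Computational_Algebra.Formal_Power_Series"
begin

definition mersenne :: "nat \<Rightarrow> real"
  where "mersenne n = 2 ^ n - 1"

primrec mfact :: "nat \<Rightarrow> real"
  where
    "mfact 0 = 1"
  | "mfact (Suc n) = mersenne (Suc n) * mfact n"

definition mbinomial :: "nat \<Rightarrow> nat \<Rightarrow> real"
  where "mbinomial n k = (if k \<le> n then mfact n / (mfact k * mfact (n - k)) else 0)"

text \<open>The formal power series in \<open>t\<close> written $e_M^{xt}$, for a scalar \<open>x\<close>; thus $e_M^t$ is \<open>mexp 1\<close>.\<close>

definition mexp :: "real \<Rightarrow> real fps"
  where "mexp x = Abs_fps (\<lambda>n. x ^ n / mfact n)"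

text \<open>
  The Mersenne--Euler polynomials, as polynomial functions of \<open>x\<close>. The quotient is one of formal
  power series in \<open>t\<close>; the denominator has constant term 2 and so is a unit. The lemmas below
  confirm the defining identities and that each function is polynomial.
\<close>

definition mersenne_Euler :: "nat \<Rightarrow> real \<Rightarrow> real"
  where "mersenne_Euler n x = mfact n * fps_nth (2 * mexp x / (mexp 1 + 1)) n"

lemma mfact_pos: "mfact n > 0"
proof (induction n)
  case (Suc n)
  have "(1 :: real) < 2 ^ Suc n"
    by (rule one_less_power) auto
  with Suc show ?case
    by (simp add: mersenne_def)
qed simp

lemma mersenne_Euler_generating_function:
  "2 * mexp x / (mexp 1 + 1) = Abs_fps (\<lambda>n. mersenne_Euler n x / mfact n)"
proof (rule fps_ext)
  fix n
  have "mfact n \<noteq> 0"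
    using mfact_pos[of n] by linarith
  then show "fps_nth (2 * mexp x / (mexp 1 + 1)) n =
      fps_nth (Abs_fps (\<lambda>n. mersenne_Euler n x / mfact n)) n"
    unfolding fps_nth_Abs_fps mersenne_Euler_def by (rule nonzero_mult_div_cancel_left[symmetric])
qed

lemma mersenne_Euler_generating_function_mult:
  "Abs_fps (\<lambda>n. mersenne_Euler n x / mfact n) * (mexp 1 + 1) = 2 * mexp x"
proof -
  have "fps_nth (mexp 1 + 1) 0 \<noteq> 0"
    by (simp add: mexp_def)
  then have "is_unit (mexp 1 + 1)"
    unfolding fps_is_unit_iff .
  then have "mexp 1 + 1 dvd 2 * mexp x"
    by (rule unit_imp_dvd)
  then show ?thesis
    unfolding mersenne_Euler_generating_function[symmetric] by (rule dvd_div_mult_self)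
qed

lemma mersenne_Euler_polynomial: "\<exists>p :: real poly. \<forall>x. mersenne_Euler n x = poly p x"
proof -
  define g :: "real fps" where "g = 2 * inverse (mexp 1 + 1)"
  have "fps_nth (mexp 1 + 1) 0 \<noteq> 0"
    by (simp add: mexp_def)
  then have quot: "2 * mexp x / (mexp 1 + 1) = mexp x * g" for x
    by (simp add: fps_divide_unit g_def mult_ac)
  have "mersenne_Euler n x =
      poly (\<Sum>i=0..n. monom (mfact n * (1 / mfact i * fps_nth g (n - i))) i) x" for x
    unfolding mersenne_Euler_def quot fps_mult_nth
    by (simp add: mexp_def poly_sum poly_monom sum_distrib_left mult_ac)
  then show ?thesis
    by blast
qed

text \<open>Matrix indices are counted from 0, so position \<open>(i, j)\<close> here is entry \<open>(i + 1, j + 1)\<close>.\<close>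

definition mersenne_Euler_mat :: "nat \<Rightarrow> real mat"
  where "mersenne_Euler_mat n =
    mat n n (\<lambda>(i, j). if j \<le> i then mbinomial i j * mersenne_Euler (i - j) 0 else 0)"

definition mersenne_Pascal_mat :: "nat \<Rightarrow> real mat"
  where "mersenne_Pascal_mat n = mat n n (\<lambda>(i, j). if j \<le> i then mbinomial i j else 0)"

end

(* For a power series f let T f be the lower triangular matrix with entries
   (mfact i / mfact j) * f_{i-j}.  It is a diagonal conjugate of the Toeplitz matrix of f, so T is a
   unital homomorphism from power series to matrices.  The Euler matrix is T of 2 / (mexp 1 + 1), the
   Pascal matrix is T of mexp 1, and the theorem is the image under T of the generating function
   identity at x = 0, where mexp 0 = 1. *)

theory Submission
  imports Defs
begin

definition fps_mat :: "nat \<Rightarrow> real fps \<Rightarrow> real mat"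
  where "fps_mat n f =
    mat n n (\<lambda>(i, j). if j \<le> i then mfact i / mfact j * fps_nth f (i - j) else 0)"

lemma mfact_nonzero [simp]: "mfact n \<noteq> 0"
  using mfact_pos[of n] by linarith

lemma dim_fps_mat [simp]: "dim_row (fps_mat n f) = n" "dim_col (fps_mat n f) = n"
  by (simp_all add: fps_mat_def)

lemma fps_mat_one: "fps_mat n 1 = 1\<^sub>m n"
  by (rule eq_matI) (auto simp: fps_mat_def)

lemma fps_mat_add: "fps_mat n (f + g) = fps_mat n f + fps_mat n g"
  by (rule eq_matI) (auto simp: fps_mat_def algebra_simps)

lemma fps_mat_const_mult: "fps_mat n (fps_const c * f) = c \<cdot>\<^sub>m fps_mat n f"
  by (rule eq_matI) (auto simp: fps_mat_def)

text \<open>In the matrix product the factors \<open>mfact k\<close> of the summation index cancel,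
  so what remains is \<open>mfact i / mfact j\<close> times the Cauchy product coefficient of index
  \<open>i - j\<close>.\<close>

lemma fps_mat_mult: "fps_mat n (f * g) = fps_mat n f * fps_mat n g"
proof (rule eq_matI)
  fix i j
  assume "i < dim_row (fps_mat n f * fps_mat n g)" "j < dim_col (fps_mat n f * fps_mat n g)"
  then have ij: "i < n" "j < n"
    by simp_all
  let ?h = "\<lambda>k. (if k \<le> i then mfact i / mfact k * fps_nth f (i - k) else 0) *
    (if j \<le> k then mfact k / mfact j * fps_nth g (k - j) else 0)"
  have "(fps_mat n f * fps_mat n g) $$ (i, j) = (\<Sum>k = 0..<n. ?h k)"
    using ij by (simp add: fps_mat_def scalar_prod_def)
  \<comment> \<open>By triangularity only \<open>j \<le> k \<le> i\<close> contributes; for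
    \<open>i < j\<close> the sum is empty, matching the zero entry above the diagonal.\<close>
  also have "\<dots> = (\<Sum>k = j..i. ?h k)"
    using ij by (intro sum.mono_neutral_right) auto
  also have "\<dots> = (\<Sum>k = j..i. mfact i / mfact j * (fps_nth g (k - j) * fps_nth f (i - k)))"
    by (rule sum.cong) auto
  also have "\<dots> = fps_mat n (f * g) $$ (i, j)"
  proof (cases "j \<le> i")
    case True
    have "(\<Sum>k = j..i. mfact i / mfact j * (fps_nth g (k - j) * fps_nth f (i - k))) =
        (\<Sum>m = 0..i - j. mfact i / mfact j * (fps_nth g m * fps_nth f (i - j - m)))"
      by (rule sum.reindex_bij_witness[where i = "\<lambda>m. m + j" and j = "\<lambda>k. k - j"])
        (use True in auto)
    also have "\<dots> = mfact i / mfact j * fps_nth (g * f) (i - j)"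
      unfolding fps_mult_nth sum_distrib_left ..
    finally show ?thesis
      using ij True by (simp add: fps_mat_def mult.commute)
  qed (use ij in \<open>simp add: fps_mat_def\<close>)
  finally show "fps_mat n (f * g) $$ (i, j) = (fps_mat n f * fps_mat n g) $$ (i, j)" ..
qed simp_all

text \<open>The coefficient \<open>1 / mfact (i - j)\<close> of \<open>mexp 1\<close> completes
  \<open>mfact i / mfact j\<close> to the M-binomial.\<close>

lemma mersenne_Pascal_mat_eq: "mersenne_Pascal_mat n = fps_mat n (mexp 1)"
  by (rule eq_matI) (auto simp: mersenne_Pascal_mat_def fps_mat_def mbinomial_def mexp_def)

lemma mersenne_Euler_mat_eq:
  "mersenne_Euler_mat n = fps_mat n (Abs_fps (\<lambda>n. mersenne_Euler n 0 / mfact n))"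
  by (rule eq_matI) (auto simp: mersenne_Euler_mat_def fps_mat_def mbinomial_def)

text \<open>Since \<open>0 ^ 0 = 1\<close>, the constant term survives.\<close>

lemma mexp_zero: "mexp 0 = 1"
  by (rule fps_ext) (simp add: mexp_def power_0_left)

theorem theorem3p2:
  fixes n :: nat
  assumes "n \<ge> 2"
  shows "invertible_mat (mersenne_Euler_mat n) \<and>
    inverts_mat (mersenne_Euler_mat n) ((1 / 2) \<cdot>\<^sub>m (mersenne_Pascal_mat n + 1\<^sub>m n)) \<and>
    inverts_mat ((1 / 2) \<cdot>\<^sub>m (mersenne_Pascal_mat n + 1\<^sub>m n)) (mersenne_Euler_mat n)"
proof -
  define e where "e = Abs_fps (\<lambda>n. mersenne_Euler n 0 / mfact n)"
  define p where "p = fps_const (1 / 2) * (mexp 1 + 1)"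
  have E: "mersenne_Euler_mat n = fps_mat n e"
    by (simp add: mersenne_Euler_mat_eq e_def)
  have P: "(1 / 2) \<cdot>\<^sub>m (mersenne_Pascal_mat n + 1\<^sub>m n) = fps_mat n p"
    by (simp only: p_def fps_mat_const_mult fps_mat_add fps_mat_one mersenne_Pascal_mat_eq)
  have "e * p = fps_const (1 / 2) * (e * (mexp 1 + 1))"
    by (simp only: p_def mult.left_commute)
  \<comment> \<open>This is the generating function identity at \<open>x = 0\<close>.\<close>
  also have "\<dots> = fps_const (1 / 2) * 2"
    by (simp only: e_def mersenne_Euler_generating_function_mult mexp_zero mult_1_right)
  also have "\<dots> = 1"
    by (simp add: numeral_fps_const)
  finally have ep: "e * p = 1" .
  \<comment> \<open>Power series commute, so \<open>e * p = 1\<close> yields both the left and the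
    right inverse.\<close>
  then have "inverts_mat (fps_mat n e) (fps_mat n p)" "inverts_mat (fps_mat n p) (fps_mat n e)"
    by (simp_all add: inverts_mat_def fps_mat_one mult.commute flip: fps_mat_mult)
  then show ?thesis
    unfolding E P invertible_mat_def by auto
qed

end
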